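(* Let $l,\lambda\ge0$, $|m|\le l$, $|\mu|\le\lambda$ be integers and let $\alpha$ be the (real) quasi-periodicity parameter. For $n\in\mathbb Z\setminus\{0\}$ put $\mathbf b=(-n,0,0)$. Denote the series $\sum_{n\ne0}H_{l,\lambda}^{m,\mu}(\mathbf b)e^{-in\alpha}$ by $\mathscr H_{l,\lambda}^{m,\mu}(\alpha)$. Then $$\mathscr H_{l,\lambda}^{m,\mu}(\alpha)=(-1)^{\lambda+\mu}\sqrt{\frac{2l+1}{2\lambda+1}}\sqrt{\binom{l+\lambda+\mu-m}{\lambda+\mu}\binom{l+\lambda+m-\mu}{\lambda-\mu}}\sqrt{\frac{4\pi}{2(l+\lambda)+1}}\Big(\mathrm{Li}_{l+\lambda+1}(e^{-i\alpha})Y_{l+\lambda}^{m-\mu}(\tfrac\pi2,\pi)+\mathrm{Li}_{l+\lambda+1}(e^{i\alpha})Y_{l+\lambda}^{m-\mu}(\tfrac\pi2,0)\Big).$$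
   Context: $Y_l^m(\theta,\phi)$ are the $L^2$-orthonormal complex spherical harmonics with Condon–Shortley phase ($\theta$ polar, $\phi$ azimuthal angle). $I_l^m(\mathbf r)=\sqrt{\frac{4\pi}{2l+1}}Y_l^m(\hat{\mathbf r})|\mathbf r|^{-l-1}$, $\hat{\mathbf r}=\mathbf r/|\mathbf r|$, and $H_{l,\lambda}^{m,\mu}(\mathbf b)=(-1)^{\lambda+\mu}\sqrt{\frac{2l+1}{2\lambda+1}}\,I_{l+\lambda}^{m-\mu}(\mathbf b)\sqrt{\binom{l+\lambda+\mu-m}{\lambda+\mu}\binom{l+\lambda+m-\mu}{\lambda-\mu}}$. The polylogarithm is defined by the series $\mathrm{Li}_s(z)=\sum_{k=1}^\infty z^k/k^s$.
   Formalization: The case l = λ = 0 with α an integer multiple of 2π is excluded, since there both the series and Li_1(1) diverge; the series is read as the limit of sums over -M ≤ n ≤ N, n ≠ 0, as M and N tend to infinity independently. *)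

theory Defs
  imports "HOL-Analysis.Analysis" "HOL-Computational_Algebra.Polynomial"
begin

text \<open>Rodrigues' formula.\<close>
definition legendre_poly :: "nat \<Rightarrow> real poly" where
  "legendre_poly l = smult (1 / (2 ^ l * fact l)) ((pderiv ^^ l) ([:-1, 0, 1:] ^ l))"

text \<open>The Condon--Shortley phase is the factor \<open>(-1) ^ m\<close>; it is not repeated in the
  normalisation of the spherical harmonics below.\<close>
definition assoc_legendre :: "nat \<Rightarrow> nat \<Rightarrow> real \<Rightarrow> real" where
  "assoc_legendre l m x =
     (-1) ^ m * sqrt (1 - x\<^sup>2) ^ m * poly ((pderiv ^^ m) (legendre_poly l)) x"

definition sph_harm_nat :: "nat \<Rightarrow> nat \<Rightarrow> real \<Rightarrow> real \<Rightarrow> complex" where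
  "sph_harm_nat l m \<theta> \<phi> =
     complex_of_real (sqrt ((2 * real l + 1) / (4 * pi) * (fact (l - m) / fact (l + m)))
                        * assoc_legendre l m (cos \<theta>))
       * exp (\<i> * of_nat m * of_real \<phi>)"

text \<open>Orders \<open>m < 0\<close> are given by \<open>Y\<^sub>l\<^sup>m = (-1)\<^sup>m cnj (Y\<^sub>l\<^sup>-\<^sup>m)\<close>.  Meaningful for
  \<open>\<bar>m\<bar> \<le> l\<close>; \<open>\<theta>\<close> is the polar and \<open>\<phi>\<close> the azimuthal angle.\<close>
definition sph_harm :: "nat \<Rightarrow> int \<Rightarrow> real \<Rightarrow> real \<Rightarrow> complex" where
  "sph_harm l m \<theta> \<phi> =
     (if m \<ge> 0 then sph_harm_nat l (nat m) \<theta> \<phi>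
      else (-1) ^ nat (- m) * cnj (sph_harm_nat l (nat (- m)) \<theta> \<phi>))"

text \<open>Spherical harmonics as functions of a unit vector.  The branch of the azimuthal angle is
  immaterial, by \<open>2 * pi\<close>-periodicity in \<open>\<phi>\<close>; at the poles, where \<open>Arg 0 = 0\<close>,
  the value does not depend on \<open>\<phi>\<close>.\<close>
definition sph_harm_dir :: "nat \<Rightarrow> int \<Rightarrow> real ^ 3 \<Rightarrow> complex" where
  "sph_harm_dir l m u = sph_harm l m (arccos (u $ 3)) (Arg (Complex (u $ 1) (u $ 2)))"

definition irreg_solid :: "nat \<Rightarrow> int \<Rightarrow> real ^ 3 \<Rightarrow> complex" where
  "irreg_solid l m r =
     of_real (sqrt (4 * pi / (2 * real l + 1))) * sph_harm_dir l m (r /\<^sub>R norm r)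
       * of_real (norm r powi (- int l - 1))"

text \<open>For \<open>\<bar>m\<bar> \<le> l\<close> and \<open>\<bar>\<mu>\<bar> \<le> \<lambda>\<close> all arguments of \<open>nat\<close> below are nonnegative.\<close>
definition trans_coeff :: "nat \<Rightarrow> nat \<Rightarrow> int \<Rightarrow> int \<Rightarrow> real ^ 3 \<Rightarrow> complex" where
  "trans_coeff l lam m \<mu> b =
     (-1) ^ nat (int lam + \<mu>) * of_real (sqrt ((2 * real l + 1) / (2 * real lam + 1)))
       * irreg_solid (l + lam) (m - \<mu>) b
       * of_real (sqrt (real (nat (int l + int lam + \<mu> - m) choose nat (int lam + \<mu>))
                        * real (nat (int l + int lam + m - \<mu>) choose nat (int lam - \<mu>))))"

definition polylog :: "complex \<Rightarrow> complex \<Rightarrow> complex" where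
  "polylog s z = (\<Sum>k. z ^ Suc k / of_nat (Suc k) powr s)"

text \<open>Two-sided series over the nonzero integers.  Upper and lower limits of summation tend to
  infinity independently; \<open>has_sum\<close> is unsuitable because for \<open>l = lam = 0\<close> the series below
  converges only conditionally.\<close>
definition nonzero_partial_sum :: "(int \<Rightarrow> complex) \<Rightarrow> nat \<times> nat \<Rightarrow> complex" where
  "nonzero_partial_sum f = (\<lambda>(M, N). \<Sum>n\<in>{- int M..int N} - {0}. f n)"

definition nonzero_sums :: "(int \<Rightarrow> complex) \<Rightarrow> complex \<Rightarrow> bool" where
  "nonzero_sums f S \<longleftrightarrow> (nonzero_partial_sum f \<longlongrightarrow> S) (sequentially \<times>\<^sub>F sequentially)"

definition nonzero_suminf :: "(int \<Rightarrow> complex) \<Rightarrow> complex" where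
  "nonzero_suminf f = (THE S. nonzero_sums f S)"

definition lattice_term :: "nat \<Rightarrow> nat \<Rightarrow> int \<Rightarrow> int \<Rightarrow> real \<Rightarrow> int \<Rightarrow> complex" where
  "lattice_term l lam m \<mu> \<alpha> n =
     trans_coeff l lam m \<mu> (vector [- of_int n, 0, 0]) * exp (- (\<i> * of_int n * of_real \<alpha>))"

definition lattice_sum :: "nat \<Rightarrow> nat \<Rightarrow> int \<Rightarrow> int \<Rightarrow> real \<Rightarrow> complex" where
  "lattice_sum l lam m \<mu> \<alpha> = nonzero_suminf (lattice_term l lam m \<mu> \<alpha>)"

end

theory Submission
  imports Defs
begin

text \<open>
  The vectors \<open>(-n, 0, 0)\<close> lie in the equatorial plane, so their polar angle is \<open>pi / 2\<close>, and
  their azimuthal angle depends only on the sign of \<open>n\<close>: it is \<open>pi\<close> for \<open>n > 0\<close> and \<open>0\<close> for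
  \<open>n < 0\<close>.  Hence the spherical harmonic is constant on each half of the lattice, and the irregular
  solid harmonic of degree \<open>L = l + lam\<close> varies only through the factor \<open>\<bar>n\<bar> ^ (- L - 1)\<close>
  (\<open>irreg_solid_axis\<close>).  Together with the phase \<open>exp (- \<i> n \<alpha>)\<close> this makes each half a constant
  multiple of a polylogarithm series of order \<open>L + 1\<close>, at \<open>exp (- \<i> \<alpha>)\<close> for \<open>n > 0\<close> and at
  \<open>exp (\<i> \<alpha>)\<close> for \<open>n < 0\<close>.

  The analytic content is the convergence of these series on the unit circle (\<open>polylog_sums\<close>).  For
  \<open>L > 0\<close> it is absolute; for \<open>L = 0\<close> it is Dirichlet's test, which needs \<open>exp (\<i> \<alpha>) \<noteq> 1\<close>.
  Since the two ends of the summation range vary independently, convergence of the halves is all that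
  the two-sided series requires (\<open>nonzero_sums_from_halves\<close>).
\<close>

text \<open>
  For this geometric numerator, summation by parts amounts to multiplying the series by \<open>1 - z\<close>: the
  result is a telescoping series minus one dominated by \<open>1 / (k + 1) - 1 / (k + 2)\<close>.
\<close>
lemma power_over_Suc_summable:
  fixes z :: complex
  assumes "norm z = 1" "z \<noteq> 1"
  shows "summable (\<lambda>k. z ^ Suc k / of_nat (Suc k))"
proof -
  define u where "u k = z ^ Suc k / of_nat (Suc k)" for k
  define v where "v k = z ^ Suc (Suc k) * of_real (1 / real (Suc k) - 1 / real (Suc (Suc k)))" for k
  have "norm (u k) = inverse (real (Suc k))" for k
    by (simp add: u_def norm_divide norm_power assms inverse_eq_divide del: of_nat_Suc power_Suc)
  then have "(\<lambda>k. norm (u k)) \<longlonglongrightarrow> 0"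
    using LIMSEQ_inverse_real_of_nat by simp
  then have "u \<longlonglongrightarrow> 0"
    by (rule tendsto_norm_zero_cancel)
  then have telescope: "summable (\<lambda>k. u k - u (Suc k))"
    using telescope_summable' by blast
  have "(\<lambda>k. 1 / real (Suc k)) \<longlonglongrightarrow> 0"
    using LIMSEQ_inverse_real_of_nat by (simp add: divide_inverse)
  then have "summable (\<lambda>k. 1 / real (Suc k) - 1 / real (Suc (Suc k)))"
    using telescope_summable' by blast
  moreover have "norm (v k) = 1 / real (Suc k) - 1 / real (Suc (Suc k))" for k
  proof -
    have "0 \<le> 1 / real (Suc k) - 1 / real (Suc (Suc k))"
      by (simp add: frac_le)
    then show ?thesis
      unfolding v_def norm_mult norm_power assms norm_of_real by simp
  qed
  ultimately have "summable (\<lambda>k. norm (v k))"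
    by (simp only:)
  then have "summable v"
    by (rule summable_norm_cancel)
  with telescope have "summable (\<lambda>k. (u k - u (Suc k)) - v k)"
    by (rule summable_diff)
  moreover have "(u k - u (Suc k)) - v k = (1 - z) * u k" for k
  proof -
    have u_eq: "u j = z ^ Suc j * of_real (1 / real (Suc j))" for j
      by (simp add: u_def)
    show ?thesis
      unfolding u_eq v_def of_real_diff power_Suc by (simp only: algebra_simps mult_1_left)
  qed
  ultimately have "summable (\<lambda>k. (1 - z) * u k)"
    by (simp only:)
  then show ?thesis
    unfolding u_def by (rule summable_mult_D) (use assms in simp)
qed

lemma polylog_sums:
  fixes z :: complex
  assumes "norm z = 1" "s = 0 \<Longrightarrow> z \<noteq> 1"
  shows "(\<lambda>k. z ^ Suc k / of_nat (Suc k) ^ Suc s) sums polylog (of_nat (s + 1)) z"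
proof -
  have "summable (\<lambda>k. z ^ Suc k / of_nat (Suc k) ^ Suc s)"
  proof (cases "s = 0")
    case True
    then show ?thesis
      using power_over_Suc_summable[of z] assms by simp
  next
    case False
    have "summable (\<lambda>k. inverse (real k ^ Suc s))"
      using False by (intro inverse_power_summable) auto
    then have "summable (\<lambda>k. inverse (real (Suc k) ^ Suc s))"
      by (subst summable_Suc_iff)
    then show ?thesis
      by (intro summable_norm_cancel[of "\<lambda>k. z ^ Suc k / of_nat (Suc k) ^ Suc s"])
        (simp add: norm_divide norm_mult norm_power assms divide_inverse norm_inverse del: of_nat_Suc power_Suc)
  qed
  moreover have "of_nat (Suc k) powr (of_nat (s + 1) :: complex) = of_nat (Suc k) ^ Suc s" for k
    using powr_nat'[of "of_nat (Suc k) :: complex" "Suc s"] by (simp del: of_nat_Suc power_Suc)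
  ultimately show ?thesis
    unfolding polylog_def by (simp add: summable_sums del: of_nat_Suc power_Suc)
qed

text \<open>
  A partial sum splits into a function of the upper limit plus a function of the lower limit, and each
  summand converges along the corresponding projection of the product filter.
\<close>
lemma nonzero_sums_from_halves:
  assumes "(\<lambda>k. f (int (Suc k))) sums P" "(\<lambda>k. f (- int (Suc k))) sums Q"
  shows "nonzero_sums f (P + Q)"
proof -
  have split: "nonzero_partial_sum f x =
      (\<Sum>k<snd x. f (int (Suc k))) + (\<Sum>k<fst x. f (- int (Suc k)))" for x
  proof -
    obtain M N where x: "x = (M, N)" by fastforce
    have "{- int M..int N} - {0} = (\<lambda>k. int (Suc k)) ` {..<N} \<union> (\<lambda>k. - int (Suc k)) ` {..<M}"
    proof (intro equalityI subsetI)
      fix n assume n: "n \<in> {- int M..int N} - {0}"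
      show "n \<in> (\<lambda>k. int (Suc k)) ` {..<N} \<union> (\<lambda>k. - int (Suc k)) ` {..<M}"
      proof (cases "n > 0")
        case True
        with n show ?thesis
          by (intro UnI1 image_eqI[where x = "nat (n - 1)"]) auto
      next
        case False
        with n show ?thesis
          by (intro UnI2 image_eqI[where x = "nat (- n - 1)"]) auto
      qed
    qed auto
    then have "nonzero_partial_sum f (M, N) =
        sum f ((\<lambda>k. int (Suc k)) ` {..<N}) + sum f ((\<lambda>k. - int (Suc k)) ` {..<M})"
      unfolding nonzero_partial_sum_def by (simp, intro sum.union_disjoint) auto
    then show ?thesis
      by (simp add: x sum.reindex inj_on_def)
  qed
  have "((\<lambda>x. (\<Sum>k<snd x. f (int (Suc k))) + (\<Sum>k<fst x. f (- int (Suc k)))) \<longlongrightarrow> P + Q)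
      (sequentially \<times>\<^sub>F sequentially)"
    using assms unfolding sums_def
    by (intro tendsto_add filterlim_compose[OF _ filterlim_fst] filterlim_compose[OF _ filterlim_snd])
  moreover have "nonzero_partial_sum f =
      (\<lambda>x. (\<Sum>k<snd x. f (int (Suc k))) + (\<Sum>k<fst x. f (- int (Suc k))))"
    by (rule ext) (rule split)
  ultimately show ?thesis
    unfolding nonzero_sums_def by (simp only:)
qed

text \<open>The sum is unique because the product filter is proper, which makes limits along it unique.\<close>
lemma nonzero_suminf_eq:
  assumes "nonzero_sums f S"
  shows "nonzero_suminf f = S"
  unfolding nonzero_suminf_def
proof (rule the_equality)
  show "nonzero_sums f S" by (rule assms)
next
  have "sequentially \<times>\<^sub>F sequentially \<noteq> (bot :: (nat \<times> nat) filter)"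
    by (simp add: prod_filter_eq_bot)
  then show "T = S" if "nonzero_sums f T" for T
    using that assms unfolding nonzero_sums_def by (rule tendsto_unique)
qed

text \<open>
  The case distinction is the azimuthal angle of \<open>(-n, 0, 0)\<close>, which is the argument of the real
  number \<open>- n / \<bar>n\<bar>\<close>.
\<close>
lemma irreg_solid_axis:
  assumes "n \<noteq> 0"
  shows "irreg_solid L M (vector [- of_int n, 0, 0]) =
    of_real (sqrt (4 * pi / (2 * real L + 1))) * sph_harm L M (pi / 2) (if n > 0 then pi else 0)
      / of_nat (nat \<bar>n\<bar>) ^ Suc L"
proof -
  have norm: "norm (vector [- of_int n, 0, 0] :: real ^ 3) = \<bar>of_int n\<bar>"
    by (simp add: norm_vec_def L2_set_def sum_3 vector_3)
  have "Arg (Complex (- of_int n / \<bar>of_int n\<bar>) 0) = (if n > 0 then pi else 0)"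
  proof (cases "n > 0")
    case True
    then have "Complex (- of_int n / \<bar>of_int n\<bar>) 0 = - 1"
      by (simp add: complex_eq_iff)
    then have "Complex (- of_int n / \<bar>of_int n\<bar>) 0 = of_real (- 1)"
      by simp
    with True show ?thesis by (simp only: Arg_of_real) simp
  next
    case False
    then have "Complex (- of_int n / \<bar>of_int n\<bar>) 0 = 1"
      using assms by (simp add: complex_eq_iff)
    with False show ?thesis by simp
  qed
  moreover have unit: "(vector [- of_int n, 0, 0] :: real ^ 3) /\<^sub>R \<bar>of_int n\<bar> =
      vector [- of_int n / \<bar>of_int n\<bar>, 0, 0]"
    by (simp add: vec_eq_iff forall_3 divide_inverse_commute)
  ultimately have "sph_harm_dir L M ((vector [- of_int n, 0, 0] :: real ^ 3) /\<^sub>R \<bar>of_int n\<bar>) =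
      sph_harm L M (pi / 2) (if n > 0 then pi else 0)"
    unfolding sph_harm_dir_def unit vector_3 by (simp only: arccos_0)
  moreover have "complex_of_real (\<bar>of_int n\<bar> powi (- int L - 1)) = inverse (of_nat (nat \<bar>n\<bar>) ^ Suc L)"
  proof -
    have "- int L - 1 = - int (Suc L)" by simp
    then have "\<bar>of_int n\<bar> powi (- int L - 1) = inverse (\<bar>of_int n\<bar> ^ Suc L :: real)"
      by (simp only: power_int_minus power_int_of_nat)
    moreover have "(\<bar>of_int n\<bar>::real) = of_nat (nat \<bar>n\<bar>)"
      by simp
    ultimately show ?thesis
      by (simp only: of_real_inverse of_real_power of_real_of_nat_eq)
  qed
  ultimately show ?thesis
    unfolding irreg_solid_def norm by (simp only: divide_inverse)
qed

lemma exp_ii_eq_1_iff: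
  "exp (\<i> * complex_of_real \<alpha>) = 1 \<longleftrightarrow> (\<exists>k::int. \<alpha> = 2 * pi * of_int k)"
  by (auto simp: exp_eq_1 mult_ac)

theorem lemma5p2:
  fixes l lam :: nat and m \<mu> :: int and \<alpha> :: real
  assumes "\<bar>m\<bar> \<le> int l" and "\<bar>\<mu>\<bar> \<le> int lam"
    and "l + lam = 0 \<Longrightarrow> (\<forall>k::int. \<alpha> \<noteq> 2 * pi * of_int k)"
  shows "nonzero_sums (lattice_term l lam m \<mu> \<alpha>) (lattice_sum l lam m \<mu> \<alpha>) \<and>
    lattice_sum l lam m \<mu> \<alpha> =
      (-1) ^ nat (int lam + \<mu>) * of_real (sqrt ((2 * real l + 1) / (2 * real lam + 1)))
      * of_real (sqrt (real (nat (int l + int lam + \<mu> - m) choose nat (int lam + \<mu>))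
                       * real (nat (int l + int lam + m - \<mu>) choose nat (int lam - \<mu>))))
      * of_real (sqrt (4 * pi / (2 * real (l + lam) + 1)))
      * (polylog (of_nat (l + lam + 1)) (exp (- (\<i> * of_real \<alpha>)))
           * sph_harm (l + lam) (m - \<mu>) (pi / 2) pi
         + polylog (of_nat (l + lam + 1)) (exp (\<i> * of_real \<alpha>))
           * sph_harm (l + lam) (m - \<mu>) (pi / 2) 0)"
    (is "_ \<and> _ = ?A * ?B * ?C * (?P * ?Yp + ?Q * ?Y0)")
proof -
  define z where "z = exp (\<i> * complex_of_real \<alpha>)"
  have exp_minus_eq: "exp (- (\<i> * complex_of_real \<alpha>)) = inverse z"
    by (simp add: z_def exp_minus)
  have norm_z: "norm z = 1" and [simp]: "z \<noteq> 0"
    by (simp_all add: z_def)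
  have z_ne_1: "z \<noteq> 1" if "l + lam = 0"
    using assms(3)[OF that] by (simp add: z_def exp_ii_eq_1_iff)
  have exp_pos: "exp (- (\<i> * of_int (int (Suc k)) * complex_of_real \<alpha>)) = inverse z ^ Suc k" for k
    unfolding exp_minus_eq[symmetric] exp_of_nat_mult[symmetric] by (simp add: mult_ac)
  have exp_neg: "exp (- (\<i> * of_int (- int (Suc k)) * complex_of_real \<alpha>)) = z ^ Suc k" for k
  proof -
    have "- (\<i> * of_int (- int (Suc k)) * complex_of_real \<alpha>) = of_nat (Suc k) * (\<i> * complex_of_real \<alpha>)"
      by (simp add: algebra_simps)
    then show ?thesis
      unfolding z_def by (simp only: exp_of_nat_mult)
  qed
  have pos: "lattice_term l lam m \<mu> \<alpha> (int (Suc k)) =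
      (?A * ?B * ?C * ?Yp) * (inverse z ^ Suc k / of_nat (Suc k) ^ Suc (l + lam))" for k
    unfolding lattice_term_def trans_coeff_def exp_pos
    by (subst irreg_solid_axis) (simp_all del: of_nat_Suc power_Suc)
  have neg: "lattice_term l lam m \<mu> \<alpha> (- int (Suc k)) =
      (?A * ?B * ?C * ?Y0) * (z ^ Suc k / of_nat (Suc k) ^ Suc (l + lam))" for k
    unfolding lattice_term_def trans_coeff_def exp_neg
    by (subst irreg_solid_axis) (simp_all del: of_nat_Suc power_Suc)
  have "nonzero_sums (lattice_term l lam m \<mu> \<alpha>) (?A * ?B * ?C * ?Yp * ?P + ?A * ?B * ?C * ?Y0 * ?Q)"
  proof (rule nonzero_sums_from_halves)
    show "(\<lambda>k. lattice_term l lam m \<mu> \<alpha> (int (Suc k))) sums (?A * ?B * ?C * ?Yp * ?P)"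
      unfolding pos exp_minus_eq
      by (intro sums_mult polylog_sums) (use norm_z z_ne_1 in \<open>auto simp: norm_inverse\<close>)
    show "(\<lambda>k. lattice_term l lam m \<mu> \<alpha> (- int (Suc k))) sums (?A * ?B * ?C * ?Y0 * ?Q)"
      unfolding neg z_def[symmetric]
      by (intro sums_mult polylog_sums) (use norm_z z_ne_1 in auto)
  qed
  then have sums: "nonzero_sums (lattice_term l lam m \<mu> \<alpha>) (?A * ?B * ?C * (?P * ?Yp + ?Q * ?Y0))"
    by (simp only: distrib_left mult_ac)
  then show ?thesis
    unfolding lattice_sum_def nonzero_suminf_eq[OF sums] by blast
qed

end
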